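(* Let $k\ge 1$ and let $\mathscr{H}^{(1)},\dots,\mathscr{H}^{(k)}$ be finite-dimensional complex Hilbert spaces, all of the same dimension $n$, and let $\mathscr{H}^{(1\div k)}=\bigotimes_{i=1}^k\mathscr{H}^{(i)}$. Let $a\in\mathcal{H}(\mathscr{H}^{(1\div k)})$ be a Hermitian operator and let $\mathcal{I}_a=\{x\in\mathcal{H}(\mathscr{H}^{(1\div k)}):(x,a)=0\}$ be its corresponding hyperplane. Then $a$ is an entanglement witness if and only if the following three conditions hold: 1. there exists $p\in\mathfrak{P}^{(1\div k)}$ such that $(p,a)>0$; 2. if $p\in\mathfrak{P}^{(1\div k)}\cap\mathcal{I}_a$, then $\mathfrak{C}(p)\subseteq\mathcal{I}_a$; 3. $a\notin\mathcal{H}^+(\mathscr{H}^{(1\div k)})$.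
   Context: For a finite-dimensional complex Hilbert space $\mathscr{H}$, $\mathcal{H}(\mathscr{H})$ is the real vector space of Hermitian operators on $\mathscr{H}$, with inner product $(x,y)=\mathrm{Tr}(x^\dagger y)=\mathrm{Tr}(xy)$. $\mathcal{H}^+(\mathscr{H})=\{x\in\mathcal{H}(\mathscr{H}):\langle\psi|x|\psi\rangle\ge 0\ \forall\psi\in\mathscr{H}\}$ is the set of positive operators, and $\mathcal{S}(\mathscr{H})$, the set of states, consists of the positive operators of trace one. On $\mathscr{H}^{(1\div k)}=\bigotimes_{i=1}^k\mathscr{H}^{(i)}$: - $\mathfrak{P}^{(1\div k)}$ is the set of pure product states, i.e. operators $\bigotimes_{j=1}^k|e^{(j)}\rangle\langle e^{(j)}|$ with $|e^{(j)}\rangle\in\mathscr{H}^{(j)}$ and $\langle e^{(j)}|e^{(j)}\rangle=1$ for all $j$. - A state $\varrho\in\mathcal{S}(\mathscr{H}^{(1\div k)})$ is separable if $\varrho=\sum_i p_i\bigotimes_{j=1}^k\varrho_i^{(j)}$ (a finite sum) with $p_i\ge0$, $\sum_i p_i=1$, $\varrho_i^{(j)}\in\mathcal{S}(\mathscr{H}^{(j)})$. The set of separable states is $\mathfrak{S}^{(1\div k)}$; it is the convex hull of $\mathfrak{P}^{(1\div k)}$. The set of entangled states is $\mathfrak{E}^{(1\div k)}=\mathcal{S}(\mathscr{H}^{(1\div k)})\setminus\mathfrak{S}^{(1\div k)}$. - $a\in\mathcal{H}(\mathscr{H}^{(1\div k)})$ is an entanglement witness if $(a,p)\ge0$ for all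 $p\in\mathfrak{S}^{(1\div k)}$ and there is at least one $q\in\mathfrak{E}^{(1\div k)}$ with $(a,q)<0$. - For $i=1,\dots,k$, $\tau^{(i)}$ is the real span of the operators $\mathbb{I}\otimes\cdots\otimes\mathbb{I}\otimes h^{(i)}\otimes\mathbb{I}\otimes\cdots\otimes\mathbb{I}$ with $h^{(i)}\in\mathcal{H}(\mathscr{H}^{(i)})$ in the $i$-th tensor factor, $\mathrm{Tr}\,h^{(i)}=0$, and identities in the other factors. $\tau$ is the real span of $\bigcup_{i=1}^k\tau^{(i)}$ (that is, $\tau=\bigoplus_{i=1}^k\tau^{(i)}$). - For $p\in\mathcal{H}(\mathscr{H}^{(1\div k)})$, $\mathfrak{C}(p)=\{\mathrm{i}[p,t]:t\in\tau\}$, where $\mathrm{i}$ is the imaginary unit and $[p,t]=pt-tp$; this is a real subspace of $\mathcal{H}(\mathscr{H}^{(1\div k)})$. *)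

theory Defs
  imports "HOL-Analysis.Analysis" "HOL-Library.Nonpos_Ints"
begin

text \<open>
  Each local Hilbert space is \<open>\<complex>\<^sup>n\<close>, i.e. \<open>complex ^ 'n\<close>, with the tensor factors labelled by
  the finite type \<open>'k\<close>.  The product basis of the tensor product is labelled by the functions
  \<open>'k \<Rightarrow> 'n\<close> (a basis index for every factor), so the composite space is
  \<open>complex ^ ('k \<Rightarrow> 'n)\<close>.  Operators are square matrices in these orthonormal bases.
\<close>

type_synonym 'm cop = "complex ^ 'm ^ 'm"

definition cinner :: "complex ^ 'm::finite \<Rightarrow> complex ^ 'm \<Rightarrow> complex" where
  "cinner u v = (\<Sum>i\<in>UNIV. cnj (u $ i) * v $ i)"

definition ketbra :: "complex ^ 'm::finite \<Rightarrow> 'm cop" where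
  "ketbra e = (\<chi> r c. e $ r * cnj (e $ c))"

definition adjoint_op :: "'m::finite cop \<Rightarrow> 'm cop" where
  "adjoint_op x = (\<chi> r c. cnj (x $ c $ r))"

definition hermitian_ops :: "'m::finite cop set" where
  "hermitian_ops = {x. adjoint_op x = x}"

text \<open>
  For Hermitian arguments the trace below is already real (\<open>hs_inner_hermitian\<close>); taking the real
  part only fixes the codomain.
\<close>

definition hs_inner :: "'m::finite cop \<Rightarrow> 'm cop \<Rightarrow> real" where
  "hs_inner x y = Re (trace (adjoint_op x ** y))"

definition positive_ops :: "'m::finite cop set" where
  "positive_ops = {x \<in> hermitian_ops. \<forall>\<psi>. cinner \<psi> (x *v \<psi>) \<in> \<real>\<^sub>\<ge>\<^sub>0}"

definition states :: "'m::finite cop set" where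
  "states = {x \<in> positive_ops. trace x = 1}"

text \<open>The Kronecker product \<open>\<Otimes>\<^sub>j A j\<close> in the product basis.\<close>

definition tensor_op :: "('k::finite \<Rightarrow> 'n::finite cop) \<Rightarrow> ('k \<Rightarrow> 'n) cop" where
  "tensor_op A = (\<chi> r c. \<Prod>j\<in>UNIV. A j $ r j $ c j)"

definition pure_product_states :: "('k::finite \<Rightarrow> 'n::finite) cop set" where
  "pure_product_states = {tensor_op (\<lambda>j. ketbra (e j)) | e. \<forall>j. cinner (e j) (e j) = 1}"

definition separable_states :: "('k::finite \<Rightarrow> 'n::finite) cop set" where
  "separable_states = {\<rho> \<in> states. \<exists>(m::nat) (p :: nat \<Rightarrow> real) (\<sigma> :: nat \<Rightarrow> 'k \<Rightarrow> 'n cop).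
     (\<forall>i<m. 0 \<le> p i) \<and> (\<Sum>i<m. p i) = 1 \<and> (\<forall>i<m. \<forall>j. \<sigma> i j \<in> states) \<and>
     \<rho> = (\<Sum>i<m. p i *\<^sub>R tensor_op (\<sigma> i))}"

definition entangled_states :: "('k::finite \<Rightarrow> 'n::finite) cop set" where
  "entangled_states = states - separable_states"

definition entanglement_witness :: "('k::finite \<Rightarrow> 'n::finite) cop \<Rightarrow> bool" where
  "entanglement_witness a \<longleftrightarrow> a \<in> hermitian_ops \<and>
     (\<forall>p\<in>separable_states. 0 \<le> hs_inner a p) \<and> (\<exists>q\<in>entangled_states. hs_inner a q < 0)"

definition local_op :: "'k::finite \<Rightarrow> 'n::finite cop \<Rightarrow> ('k \<Rightarrow> 'n) cop" where
  "local_op i h = tensor_op ((\<lambda>_. mat 1)(i := h))"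

text \<open>\<open>span\<close> is the real linear span.\<close>

definition tau_factor :: "'k::finite \<Rightarrow> ('k \<Rightarrow> 'n::finite) cop set" where
  "tau_factor i = span {local_op i h | h. h \<in> hermitian_ops \<and> trace h = 0}"

definition tau :: "('k::finite \<Rightarrow> 'n::finite) cop set" where
  "tau = span (\<Union>i. tau_factor i)"

definition i_commutator :: "'m::finite cop \<Rightarrow> 'm cop \<Rightarrow> 'm cop" where
  "i_commutator p t = (\<chi> r c. \<i> * (p ** t - t ** p) $ r $ c)"

definition commutator_space :: "('k::finite \<Rightarrow> 'n::finite) cop \<Rightarrow> ('k \<Rightarrow> 'n) cop set" where
  "commutator_space p = {i_commutator p t | t. t \<in> tau}"

definition hyperplane :: "'m::finite cop \<Rightarrow> 'm cop set" where
  "hyperplane a = {x \<in> hermitian_ops. hs_inner x a = 0}"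

lemma hs_inner_hermitian:
  assumes "x \<in> hermitian_ops" "y \<in> hermitian_ops"
  shows "complex_of_real (hs_inner x y) = trace (x ** y)"
proof -
  have x: "adjoint_op x = x" and y: "adjoint_op y = y"
    using assms by (auto simp: hermitian_ops_def)
  have ex: "cnj (x $ r $ c) = x $ c $ r" for r c
    by (metis (no_types, lifting) adjoint_op_def x vec_lambda_beta)
  have ey: "cnj (y $ r $ c) = y $ c $ r" for r c
    by (metis (no_types, lifting) adjoint_op_def y vec_lambda_beta)
  have "cnj (trace (x ** y)) = (\<Sum>i\<in>UNIV. \<Sum>j\<in>UNIV. x $ j $ i * y $ i $ j)"
    by (simp add: trace_def matrix_matrix_mult_def ex ey)
  also have "\<dots> = trace (x ** y)"
    by (subst sum.swap) (simp add: trace_def matrix_matrix_mult_def)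
  finally have "trace (x ** y) \<in> \<real>"
    by (simp add: Reals_cnj_iff)
  then show ?thesis
    by (simp add: hs_inner_def x)
qed

end

theory Submission
  imports Defs
begin

text \<open>
  Write \<open>F e = \<langle>E|a|E\<rangle>\<close> with \<open>E\<close> the tensor product of the \<open>e j\<close>, for arbitrary (not necessarily
  unit) vectors.  With all but one factor fixed, \<open>F\<close> is the quadratic form of a Hermitian form on
  that factor, and condition 2 says exactly that this form annihilates every vector on which its
  quadratic form vanishes.  A form with this property cannot be indefinite.  If \<open>F\<close> took both signs,
  say at \<open>e\<close> and \<open>g\<close>, then in each factor \<open>i\<close> one of \<open>e i\<close>, \<open>g i\<close>, \<open>e i + g i\<close> could replace both
  \<open>e i\<close> and \<open>g i\<close> without changing the two signs; after all factors have been treated the two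
  families coincide, a contradiction.  So condition 1 forces \<open>F \<ge> 0\<close>, and condition 3 provides the
  detected entangled state.  Conversely, at a zero of \<open>F \<ge> 0\<close> each of these forms is positive
  semidefinite and therefore annihilates the null vector, which is condition 2; and \<open>F\<close> vanishes
  identically only for \<open>a = 0\<close>, by polarization factor by factor.
\<close>

section \<open>Sesquilinear forms\<close>

locale sesquilinear_form =
  fixes B :: "complex ^ 'm::finite \<Rightarrow> complex ^ 'm \<Rightarrow> complex"
  assumes add_left: "B (x + y) z = B x z + B y z"
    and add_right: "B x (y + z) = B x y + B x z"
    and scale_left: "B (c *s x) y = cnj c * B x y"
    and scale_right: "B x (c *s y) = c * B x y"
begin

text \<open>Polarization over the complex numbers: the diagonal at \<open>x + y\<close> kills the
  symmetric part \<open>B x y + B y x\<close>, the diagonal at \<open>x + \<i> *s y\<close> the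
  antisymmetric part.\<close>

lemma zero_if_diagonal_zero:
  assumes "\<And>z. B z z = 0"
  shows "B x y = 0"
proof -
  have 1: "B x y + B y x = 0"
    using assms[of "x + y"] assms[of x] assms[of y] by (simp add: add_left add_right add.commute)
  have "\<i> * (B x y - B y x) = 0"
    using assms[of "x + \<i> *s y"] assms[of x] assms[of y]
    by (simp add: add_left add_right scale_left scale_right algebra_simps)
  with 1 show ?thesis
    by simp
qed

end

locale hermitian_form = sesquilinear_form +
  assumes cnj_swap: "cnj (B x y) = B y x"
begin

lemma diagonal_real: "B x x = complex_of_real (Re (B x x))"
  by (metis Reals_cnj_iff cnj_swap complex_is_Real_iff of_real_Re)

text \<open>Since \<open>B u u = 0\<close>, moving \<open>v\<close> along \<open>u\<close> changes
  the quadratic form affinely; if \<open>B v u\<close> were nonzero, the form would be unbounded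
  below.\<close>

lemma annihilates_null_if_nonneg:
  assumes nonneg: "\<And>z. 0 \<le> Re (B z z)" and "B u u = 0"
  shows "B v u = 0"
proof (rule ccontr)
  assume nz: "B v u \<noteq> 0"
  define b where "b = B v u"
  \<comment> \<open>This \<open>s\<close> brings the real part of the form at
    \<open>v + c *s u\<close> to exactly -1.\<close>
  define s where "s = (Re (B v v) + 1) / (2 * (cmod b)\<^sup>2)"
  define c where "c = - complex_of_real s * cnj b"
  have "B u v = cnj b"
    by (simp add: b_def cnj_swap)
  then have "B (v + c *s u) (v + c *s u) = B v v + c * b + cnj (c * b)"
    using \<open>B u u = 0\<close> by (simp add: add_left add_right scale_left scale_right b_def)
  moreover have "c * b = complex_of_real (- s * (cmod b)\<^sup>2)"
    unfolding c_def using complex_norm_square[of b] by (simp add: mult.commute)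
  ultimately have "Re (B (v + c *s u) (v + c *s u)) = Re (B v v) - 2 * s * (cmod b)\<^sup>2"
    by simp
  moreover have "2 * s * (cmod b)\<^sup>2 = Re (B v v) + 1"
    using nz by (simp add: s_def b_def)
  ultimately show False
    using nonneg[of "v + c *s u"] by simp
qed

text \<open>If the form took both signs, the real line through \<open>x\<close> in direction
  \<open>z\<close> would contain a null vector. Pairing that vector with \<open>x\<close> and with
  \<open>z\<close> gives \<open>p + t * q = 0\<close> and \<open>q + t * r = 0\<close>, so
  \<open>p = t\<^sup>2 * r\<close>, which is impossible for \<open>p > 0 > r\<close>.\<close>

lemma nonneg_if_annihilates_null:
  assumes null: "\<And>u v. B u u = 0 \<Longrightarrow> B v u = 0" and pos: "0 < Re (B x x)"
  shows "0 \<le> Re (B z z)"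
proof (rule ccontr)
  assume neg: "\<not> ?thesis"
  define p q r where "p = Re (B x x)" and "q = Re (B x z)" and "r = Re (B z z)"
  have quad: "B (x + of_real t *s z) (x + of_real t *s z) = of_real (p + 2 * q * t + r * t\<^sup>2)"
    for t :: real
  proof -
    have "B x z + B z x = of_real (2 * q)"
      using cnj_swap[of x z] unfolding q_def by (metis complex_add_cnj)
    then have "of_real t * B x z + of_real t * B z x = complex_of_real (2 * q * t)"
      by (metis distrib_left mult.commute of_real_mult)
    then show ?thesis
      using diagonal_real[of x] diagonal_real[of z]
      by (simp add: add_left add_right scale_left scale_right p_def r_def algebra_simps
          power2_eq_square)
  qed
  have "0 < p" "r < 0"
    using pos neg by (auto simp: p_def r_def)
  \<comment> \<open>The quadratic in \<open>t\<close> has a real root because \<open>p\<close> and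
    \<open>r\<close> have opposite signs, which makes the discriminant positive;
    \<open>(d - q) / r\<close> is such a root.\<close>
  obtain t where t: "p + 2 * q * t + r * t\<^sup>2 = 0"
  proof -
    define d where "d = sqrt (q\<^sup>2 - r * p)"
    have "0 \<le> q\<^sup>2 - r * p"
      using \<open>0 < p\<close> \<open>r < 0\<close> by (smt (verit) mult_neg_pos zero_le_power2)
    then have d: "d\<^sup>2 = q\<^sup>2 - r * p"
      by (simp add: d_def)
    have "r * (p + 2 * q * ((d - q) / r) + r * ((d - q) / r)\<^sup>2) = r * p + 2 * q * (d - q) + (d - q)\<^sup>2"
      using \<open>r < 0\<close> by (simp add: field_simps power2_eq_square)
    also have "\<dots> = 0"
      using d by (simp add: power2_eq_square algebra_simps)
    finally have "p + 2 * q * ((d - q) / r) + r * ((d - q) / r)\<^sup>2 = 0"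
      using \<open>r < 0\<close> by simp
    then show thesis
      by (rule that)
  qed
  have "B v (x + of_real t *s z) = 0" for v
    by (rule null) (simp only: quad t of_real_0)
  then have "B x x + of_real t * B x z = 0" "B z x + of_real t * B z z = 0"
    by (simp_all add: add_right scale_right)
  then have "p + t * q = 0" "q + t * r = 0"
    using cnj_swap[of x z]
    by (auto simp: p_def q_def r_def complex_eq_iff dest!: arg_cong[of _ _ Re])
  then have "p = t\<^sup>2 * r"
    by (simp add: power2_eq_square algebra_simps) (smt (verit) mult.assoc mult.commute mult_minus_left)
  then show False
    using \<open>0 < p\<close> \<open>r < 0\<close> by (smt (verit) mult_nonneg_nonpos zero_le_power2)
qed

end

section \<open>The sesquilinear form of an operator\<close>

definition op_form :: "'m::finite cop \<Rightarrow> complex ^ 'm \<Rightarrow> complex ^ 'm \<Rightarrow> complex" where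
  "op_form a u v = cinner u (a *v v)"

lemma cinner_add_left: "cinner (x + y) z = cinner x z + cinner y z"
  and cinner_add_right: "cinner x (y + z) = cinner x y + cinner x z"
  and cinner_scale_left: "cinner (c *s x) y = cnj c * cinner x y"
  and cinner_scale_right: "cinner x (c *s y) = c * cinner x y"
  and cinner_diff_right: "cinner x (y - z) = cinner x y - cinner x z"
  and cnj_cinner: "cnj (cinner x y) = cinner y x"
  by (simp_all add: cinner_def algebra_simps sum.distrib sum_distrib_left sum_subtractf)

lemma cinner_self: "cinner e e = complex_of_real ((norm e)\<^sup>2)"
proof -
  have "cinner e e = (\<Sum>i\<in>UNIV. complex_of_real ((cmod (e $ i))\<^sup>2))"
    unfolding cinner_def complex_norm_square by (simp add: mult.commute)
  then show ?thesis
    by (simp add: norm_vec_def L2_set_def sum_nonneg)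
qed

lemma op_form_sum: "op_form a u v = (\<Sum>r\<in>UNIV. \<Sum>c\<in>UNIV. cnj (u $ r) * a $ r $ c * v $ c)"
  by (simp add: op_form_def cinner_def matrix_vector_mult_def sum_distrib_left mult.assoc)

lemma op_form_axis: "op_form a u (axis c 1) = (\<Sum>r\<in>UNIV. cnj (u $ r) * a $ r $ c)"
  "op_form a (axis r 1) (axis c 1) = a $ r $ c"
  by (simp_all add: op_form_sum axis_def if_distrib[of "\<lambda>x. _ * x"] if_distrib[of cnj]
      if_distrib[of "\<lambda>x. x * _"] cong: if_cong)

lemma hermitian_ops_entry: "a \<in> hermitian_ops \<longleftrightarrow> (\<forall>r c. cnj (a $ r $ c) = a $ c $ r)"
  by (auto simp: hermitian_ops_def adjoint_op_def vec_eq_iff)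

lemma subspace_hermitian_ops: "subspace (hermitian_ops :: 'm::finite cop set)"
  by (auto simp: subspace_def hermitian_ops_entry)

lemma sesquilinear_form_op_form: "sesquilinear_form (op_form a)"
  by unfold_locales
    (simp_all add: op_form_def cinner_add_left cinner_add_right cinner_scale_left
      cinner_scale_right matrix_vector_right_distrib vector_scalar_commute)

lemma hermitian_form_op_form:
  assumes "a \<in> hermitian_ops"
  shows "hermitian_form (op_form a)"
proof -
  interpret sesquilinear_form "op_form a"
    by (rule sesquilinear_form_op_form)
  have "cnj (op_form a x y) = op_form a y x" for x y
  proof -
    have "cnj (op_form a x y) = (\<Sum>r\<in>UNIV. \<Sum>c\<in>UNIV. cnj (y $ c) * a $ c $ r * x $ r)"
      using assms by (simp add: op_form_sum hermitian_ops_entry mult_ac)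
    also have "\<dots> = op_form a y x"
      unfolding op_form_sum by (rule sum.swap)
    finally show ?thesis .
  qed
  then show ?thesis
    by unfold_locales
qed

section \<open>Positive operators\<close>

lemma positive_ops_iff:
  "a \<in> positive_ops \<longleftrightarrow> a \<in> hermitian_ops \<and> (\<forall>u. 0 \<le> Re (op_form a u u))"
proof -
  have "Im (op_form a u u) = 0" if "a \<in> hermitian_ops" for u
  proof -
    interpret hermitian_form "op_form a"
      using that by (rule hermitian_form_op_form)
    show ?thesis
      by (metis Im_complex_of_real diagonal_real)
  qed
  then show ?thesis
    by (auto simp: positive_ops_def op_form_def complex_nonneg_Reals_iff)
qed

text \<open>Expanding the trace entrywise gives the Euclidean inner product of the underlying real
  vector space; symmetry and real bilinearity are then inherited from it.\<close>

lemma hs_inner_eq_inner: "hs_inner x y = x \<bullet> y"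
proof -
  have "hs_inner x y = (\<Sum>i\<in>UNIV. \<Sum>k\<in>UNIV. Re (cnj (x $ k $ i) * y $ k $ i))"
    by (simp add: hs_inner_def trace_def matrix_matrix_mult_def adjoint_op_def)
  also have "\<dots> = (\<Sum>k\<in>UNIV. \<Sum>i\<in>UNIV. Re (cnj (x $ k $ i) * y $ k $ i))"
    by (rule sum.swap)
  also have "\<dots> = x \<bullet> y"
    by (simp add: inner_vec_def inner_complex_def)
  finally show ?thesis .
qed

lemma trace_mult_ketbra: "trace (m ** ketbra e) = op_form m e e"
  by (simp add: trace_def matrix_matrix_mult_def ketbra_def op_form_sum mult_ac)

lemma hs_inner_ketbra:
  assumes "a \<in> hermitian_ops"
  shows "hs_inner a (ketbra e) = Re (op_form a e e)"
  using assms by (simp add: hs_inner_def hermitian_ops_def trace_mult_ketbra)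

lemma ketbra_hermitian: "ketbra e \<in> hermitian_ops"
  by (simp add: hermitian_ops_entry ketbra_def)

lemma op_form_ketbra: "op_form (ketbra e) u u = complex_of_real ((cmod (cinner e u))\<^sup>2)"
proof -
  have "op_form (ketbra e) u u = cinner u e * cinner e u"
    by (simp add: op_form_sum ketbra_def cinner_def sum_product mult_ac)
  also have "\<dots> = cinner e u * cnj (cinner e u)"
    by (simp add: cnj_cinner)
  finally show ?thesis
    by (simp only: complex_norm_square)
qed

lemma ketbra_in_states:
  assumes "cinner e e = 1"
  shows "ketbra e \<in> states"
proof -
  have "trace (ketbra e) = cinner e e"
    by (simp add: trace_def ketbra_def cinner_def mult.commute)
  then show ?thesis
    using assms by (simp add: states_def positive_ops_iff ketbra_hermitian op_form_ketbra)
qed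

text \<open>
  Subtracting the rank one operator of a column with nonzero diagonal entry leaves a positive
  operator (a Schur complement) with fewer nonzero diagonal entries.
\<close>

lemma positive_op_sum_ketbra:
  fixes x :: "'m::finite cop"
  assumes "x \<in> positive_ops"
  shows "\<exists>m (v :: nat \<Rightarrow> complex ^ 'm). x = (\<Sum>l<m. ketbra (v l))"
  using assms
proof (induction "card {i. x $ i $ i \<noteq> 0}" arbitrary: x rule: less_induct)
  case less
  have herm: "x \<in> hermitian_ops" and nonneg: "\<And>u. 0 \<le> Re (op_form x u u)"
    using less.prems by (auto simp: positive_ops_iff)
  interpret hermitian_form "op_form x"
    using herm by (rule hermitian_form_op_form)
  \<comment> \<open>A zero diagonal entry makes the basis vector \<open>axis j 1\<close> null for a
    nonnegative form, so the whole column \<open>j\<close> vanishes.\<close>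
  have col_zero: "x $ r $ j = 0" if "x $ j $ j = 0" for r j
    using annihilates_null_if_nonneg[OF nonneg, of "axis j 1" "axis r 1"] that
    by (simp add: op_form_axis(2))
  show ?case
  proof (cases "\<forall>i. x $ i $ i = 0")
    case True
    then have "x = (\<Sum>l<(0::nat). ketbra (undefined l))"
      by (simp add: vec_eq_iff col_zero)
    then show ?thesis
      by blast
  next
    case False
    then obtain i where i: "x $ i $ i \<noteq> 0"
      by blast
    define d where "d = Re (x $ i $ i)"
    have xd: "x $ i $ i = of_real d"
      using diagonal_real[of "axis i 1"] by (simp add: op_form_axis(2) d_def)
    have "0 < d"
      using nonneg[of "axis i 1"] i xd by (simp add: op_form_axis(2) order_less_le)
    \<comment> \<open>\<open>w\<close> is column \<open>i\<close> scaled so that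
      \<open>ketbra w\<close> agrees with \<open>x\<close> on row and column
      \<open>i\<close>.\<close>
    define w where "w = (\<chi> r. x $ r $ i / of_real (sqrt d))"
    define y where "y = x - ketbra w"
    have y_entry: "y $ r $ c = x $ r $ c - x $ r $ i * x $ i $ c / of_real d" for r c
    proof -
      have "complex_of_real (sqrt d) * complex_of_real (sqrt d) = of_real d"
        using \<open>0 < d\<close> by (simp flip: of_real_mult)
      then show ?thesis
        using herm by (simp add: y_def ketbra_def w_def hermitian_ops_entry)
    qed
    have y_herm: "y \<in> hermitian_ops"
      unfolding y_def by (intro subspace_diff subspace_hermitian_ops herm ketbra_hermitian)
    have "y \<in> positive_ops"
      unfolding positive_ops_iff
    proof (intro conjI allI y_herm)
      fix u
      define b where "b = op_form x u (axis i 1)"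
      \<comment> \<open>This \<open>c\<close> minimizes the form of \<open>x\<close> on the vectors
        \<open>u + c *s axis i 1\<close> (complete the square); the minimum equals
        \<open>op_form y u u\<close>, which is therefore nonnegative.\<close>
      define c where "c = - cnj b / of_real d"
      have b': "op_form x (axis i 1) u = cnj b"
        by (simp add: b_def cnj_swap)
      have "cinner w u = cnj b / of_real (sqrt d)"
      proof -
        have "cinner u w = b / of_real (sqrt d)"
          by (simp add: b_def op_form_axis(1) cinner_def w_def sum_divide_distrib)
        then show ?thesis
          by (simp flip: cnj_cinner[of u w])
      qed
      then have "op_form (ketbra w) u u = of_real ((cmod b)\<^sup>2 / d)"
        using \<open>0 < d\<close> by (simp add: op_form_ketbra norm_divide power_divide)
      moreover have "op_form y u u = op_form x u u - op_form (ketbra w) u u"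
        by (simp add: y_def op_form_def matrix_vector_mult_diff_rdistrib cinner_diff_right)
      moreover have "op_form x (u + c *s axis i 1) (u + c *s axis i 1)
          = op_form x u u - of_real ((cmod b)\<^sup>2 / d)"
      proof -
        have "op_form x (u + c *s axis i 1) (u + c *s axis i 1)
            = op_form x u u + c * b + cnj c * cnj b + cnj c * c * of_real d"
          using b' xd
          by (simp add: add_left add_right scale_left scale_right op_form_axis(2) algebra_simps
              flip: b_def)
        also have "\<dots> = op_form x u u - b * cnj b / of_real d"
          using \<open>0 < d\<close> by (simp add: c_def field_simps)
        finally show ?thesis
          by (simp add: complex_norm_square del: of_real_power)
      qed
      ultimately show "0 \<le> Re (op_form y u u)"
        using nonneg[of "u + c *s axis i 1"] by simp
    qed
    moreover have "{j. y $ j $ j \<noteq> 0} \<subset> {j. x $ j $ j \<noteq> 0}"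
    proof -
      have "y $ j $ j = 0" if "x $ j $ j = 0" for j
        using that col_zero by (simp add: y_entry)
      moreover have "y $ i $ i = 0"
        using xd \<open>0 < d\<close> by (simp add: y_entry)
      ultimately show ?thesis
        using i by blast
    qed
    then have "card {j. y $ j $ j \<noteq> 0} < card {j. x $ j $ j \<noteq> 0}"
      by (intro psubset_card_mono) auto
    ultimately obtain m v where "y = (\<Sum>l<(m::nat). ketbra (v l))"
      using less.hyps by blast
    then have "x = (\<Sum>l<Suc m. ketbra ((v(m := w)) l))"
      by (simp add: y_def algebra_simps)
    then show ?thesis
      by blast
  qed
qed

section \<open>Product vectors\<close>

definition tensor_vec :: "('k::finite \<Rightarrow> complex ^ 'n::finite) \<Rightarrow> complex ^ ('k \<Rightarrow> 'n)" where
  "tensor_vec e = (\<chi> r. \<Prod>j\<in>UNIV. e j $ r j)"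

text \<open>Isolates the factor touched by an update; the abstract \<open>f\<close> covers the
  entries of product vectors and of product operators alike.\<close>

lemma prod_upd: "(\<Prod>j\<in>UNIV. f ((e(i := z)) j) j) = f z i * (\<Prod>j\<in>UNIV - {i}. f (e j) j)"
  for f :: "_ \<Rightarrow> 'k::finite \<Rightarrow> 'c::comm_monoid_mult"
proof -
  have "(\<Prod>j\<in>UNIV. f ((e(i := z)) j) j)
      = f ((e(i := z)) i) i * (\<Prod>j\<in>UNIV - {i}. f ((e(i := z)) j) j)"
    by (rule prod.remove) auto
  also have "(\<Prod>j\<in>UNIV - {i}. f ((e(i := z)) j) j) = (\<Prod>j\<in>UNIV - {i}. f (e j) j)"
    by (rule prod.cong) auto
  finally show ?thesis
    by simp
qed

lemma tensor_vec_upd: "tensor_vec (e(i := z)) $ r = z $ r i * (\<Prod>j\<in>UNIV - {i}. e j $ r j)"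
  using prod_upd[of "\<lambda>x j. x $ r j"] by (simp add: tensor_vec_def)

lemma tensor_vec_add: "tensor_vec (e(i := x + y)) = tensor_vec (e(i := x)) + tensor_vec (e(i := y))"
  and tensor_vec_scale: "tensor_vec (e(i := c *s x)) = c *s tensor_vec (e(i := x))"
  by (simp_all add: vec_eq_iff tensor_vec_upd algebra_simps)

lemma tensor_vec_scale_all: "tensor_vec (\<lambda>j. c j *s e j) = (\<Prod>j\<in>UNIV. c j) *s tensor_vec e"
  by (simp add: vec_eq_iff tensor_vec_def prod.distrib)

lemma tensor_vec_eq_0:
  assumes "e j = 0"
  shows "tensor_vec e = 0"
  using assms by (auto simp: tensor_vec_def vec_eq_iff intro: exI[of _ j])

lemma tensor_vec_axis:
  fixes r :: "'k::finite \<Rightarrow> 'n::finite"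
  shows "tensor_vec (\<lambda>j. axis (r j) 1) = axis r 1"
proof -
  have "(\<Prod>j\<in>UNIV. axis (r j) 1 $ s j) = (axis r 1 $ s :: complex)" for s
  proof (cases "s = r")
    case False
    then obtain j where "s j \<noteq> r j"
      by blast
    then have "(\<Prod>j\<in>UNIV. axis (r j) 1 $ s j) = (0::complex)"
      by (intro prod_zero) (auto simp: axis_def)
    with False show ?thesis
      by (simp add: axis_def)
  qed (simp add: axis_def)
  then show ?thesis
    by (simp add: tensor_vec_def vec_eq_iff)
qed

text \<open>Distributivity. A basis label of the composite space is a function, so a sum over the
  product basis of a product of local terms factorizes.\<close>

lemma sum_prod_fun:
  fixes f :: "'k::finite \<Rightarrow> 'n::finite \<Rightarrow> 'c::comm_semiring_1"
  shows "(\<Sum>r\<in>UNIV. \<Prod>j\<in>UNIV. f j (r j)) = (\<Prod>j\<in>UNIV. \<Sum>s\<in>UNIV. f j s)"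
  using prod_sum_PiE[of UNIV "\<lambda>_. UNIV" f] by (simp add: PiE_UNIV_domain)

lemma cinner_tensor_vec: "cinner (tensor_vec u) (tensor_vec v) = (\<Prod>j\<in>UNIV. cinner (u j) (v j))"
  using sum_prod_fun[of "\<lambda>j s. cnj (u j $ s) * v j $ s"]
  by (simp add: cinner_def tensor_vec_def prod.distrib)

lemma tensor_op_mult_tensor_vec: "tensor_op A *v tensor_vec e = tensor_vec (\<lambda>j. A j *v e j)"
proof -
  have "(\<Sum>c\<in>UNIV. (\<Prod>j\<in>UNIV. A j $ r j $ c j) * (\<Prod>j\<in>UNIV. e j $ c j))
      = (\<Prod>j\<in>UNIV. \<Sum>s\<in>UNIV. A j $ r j $ s * e j $ s)" for r
    using sum_prod_fun[of "\<lambda>j s. A j $ r j $ s * e j $ s"] by (simp add: prod.distrib)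
  then show ?thesis
    by (simp add: vec_eq_iff matrix_vector_mult_def tensor_op_def tensor_vec_def)
qed

lemma tensor_op_ketbra: "tensor_op (\<lambda>j. ketbra (e j)) = ketbra (tensor_vec e)"
  by (simp add: vec_eq_iff tensor_op_def ketbra_def tensor_vec_def prod.distrib)

text \<open>Linearity in one slot, for splitting a positive local operator into rank one operators
  while the other factors stay fixed.\<close>

lemma tensor_op_sum:
  fixes M :: "'a \<Rightarrow> 'n::finite cop"
  assumes "finite S"
  shows "tensor_op (A(i := \<Sum>l\<in>S. M l)) = (\<Sum>l\<in>S. tensor_op (A(i := M l)))"
proof -
  have entry: "tensor_op (A(i := m)) $ r $ c = m $ r i $ c i * (\<Prod>j\<in>UNIV - {i}. A j $ r j $ c j)"
    for m r c
    using prod_upd[of "\<lambda>x j. x $ r j $ c j"] by (simp add: tensor_op_def)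
  show ?thesis
    by (simp add: vec_eq_iff entry sum_distrib_right)
qed

lemma local_op_mult_tensor_vec: "local_op i h *v tensor_vec e = tensor_vec (e(i := h *v e i))"
proof -
  have "(\<lambda>j. ((\<lambda>_. mat 1)(i := h)) j *v e j) = e(i := h *v e i)"
    by auto
  then show ?thesis
    by (simp only: local_op_def tensor_op_mult_tensor_vec)
qed

lemma local_op_hermitian:
  assumes "h \<in> hermitian_ops"
  shows "local_op i h \<in> hermitian_ops"
proof -
  have "cnj (((\<lambda>_. mat 1)(i := h)) j $ r $ c) = ((\<lambda>_. mat 1)(i := h)) j $ c $ r" for j r c
    using assms by (auto simp: hermitian_ops_entry mat_def)
  then show ?thesis
    by (simp add: hermitian_ops_entry local_op_def tensor_op_def)
qed

lemma pure_product_states_iff: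
  fixes p :: "('k::finite \<Rightarrow> 'n::finite) cop"
  shows "p \<in> pure_product_states \<longleftrightarrow> (\<exists>e. p = ketbra (tensor_vec e) \<and> (\<forall>j. cinner (e j) (e j) = 1))"
  by (auto simp: pure_product_states_def tensor_op_ketbra)

lemma pure_product_states_separable: "pure_product_states \<subseteq> separable_states"
proof
  fix p :: "('k::finite \<Rightarrow> 'n::finite) cop"
  assume "p \<in> pure_product_states"
  then obtain e where p: "p = tensor_op (\<lambda>j. ketbra (e j))" and e: "\<And>j. cinner (e j) (e j) = 1"
    by (auto simp: pure_product_states_def)
  have "p \<in> states"
    unfolding p tensor_op_ketbra by (rule ketbra_in_states) (simp add: cinner_tensor_vec e)
  then show "p \<in> separable_states"
    unfolding separable_states_def
    using p e
    by (intro CollectI conjI exI[of _ "Suc 0"] exI[of _ "\<lambda>_. 1"] exI[of _ "\<lambda>_ j. ketbra (e j)"])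
      (auto intro: ketbra_in_states)
qed

section \<open>Normalization, and forms in a single factor\<close>

lemma normalize_vector:
  fixes e :: "complex ^ 'n::finite"
  assumes "e \<noteq> 0"
  obtains f where "cinner f f = 1" "e = of_real (norm e) *s f"
proof
  let ?f = "of_real (1 / norm e) *s e"
  have "cinner ?f ?f = of_real ((1 / norm e) * (1 / norm e) * (norm e)\<^sup>2)"
    unfolding cinner_scale_left cinner_scale_right cinner_self[of e] by simp
  also have "(1 / norm e) * (1 / norm e) * (norm e)\<^sup>2 = 1"
    using assms by (simp add: power2_eq_square)
  finally show "cinner ?f ?f = 1"
    by simp
  show "e = of_real (norm e) *s ?f"
    using assms by (simp add: vec_eq_iff)
qed

text \<open>Pure product states come from unit vectors, while the sign argument also uses sums of
  vectors; positive rescaling in each factor links the two settings.\<close>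

lemma normalize_family:
  fixes e :: "'k::finite \<Rightarrow> complex ^ 'n::finite"
  assumes "\<And>j. e j \<noteq> 0"
  shows "\<exists>f c. (\<forall>j. cinner (f j) (f j) = 1) \<and> (\<forall>j. 0 < c j) \<and>
    e = (\<lambda>j. complex_of_real (c j) *s f j)"
proof -
  have "\<exists>f. cinner f f = 1 \<and> e j = of_real (norm (e j)) *s f" for j
    using normalize_vector[OF assms] by blast
  then obtain f where "\<And>j. cinner (f j) (f j) = 1 \<and> e j = of_real (norm (e j)) *s f j"
    by metis
  then show ?thesis
    using assms by (intro exI[of _ f] exI[of _ "\<lambda>j. norm (e j)"]) auto
qed

text \<open>Two independent families \<open>u\<close> and \<open>v\<close> are allowed because
  factorwise polarization runs while the remaining factors already differ on the two sides.\<close>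

lemma sesquilinear_form_partial:
  "sesquilinear_form (\<lambda>x y. op_form a (tensor_vec (u(i := x))) (tensor_vec (v(i := y))))"
proof -
  interpret sesquilinear_form "op_form a"
    by (rule sesquilinear_form_op_form)
  show ?thesis
    by unfold_locales
      (simp_all add: tensor_vec_add tensor_vec_scale add_left add_right scale_left scale_right)
qed

lemma hermitian_form_partial:
  assumes "a \<in> hermitian_ops"
  shows "hermitian_form (\<lambda>x y. op_form a (tensor_vec (e(i := x))) (tensor_vec (e(i := y))))"
proof -
  interpret a: hermitian_form "op_form a"
    using assms by (rule hermitian_form_op_form)
  interpret sesquilinear_form "\<lambda>x y. op_form a (tensor_vec (e(i := x))) (tensor_vec (e(i := y)))"
    by (rule sesquilinear_form_partial)
  show ?thesis
    by unfold_locales (rule a.cnj_swap)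
qed

section \<open>The product form of a Hermitian operator\<close>

definition product_form ::
  "('k::finite \<Rightarrow> 'n::finite) cop \<Rightarrow> ('k \<Rightarrow> complex ^ 'n) \<Rightarrow> ('k \<Rightarrow> complex ^ 'n) \<Rightarrow> complex" where
  "product_form a u v = op_form a (tensor_vec u) (tensor_vec v)"

text \<open>Induction on the set \<open>J\<close> of factors in which \<open>u\<close> and
  \<open>v\<close> may differ, polarizing in one factor at a time. Once all factors are free, basis
  vectors read off every entry of \<open>a\<close>.\<close>

lemma product_form_zero:
  assumes "\<And>e. product_form a e e = 0"
  shows "a = 0"
proof -
  have "\<forall>u v. (\<forall>j. j \<notin> J \<longrightarrow> u j = v j) \<longrightarrow> product_form a u v = 0" if "finite J" for J
    using that
  proof induction
    case empty
    have "u = v" if "\<forall>j. j \<notin> {} \<longrightarrow> u j = v j" for u v :: "'a \<Rightarrow> complex ^ 'b"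
      using that by auto
    then show ?case
      using assms by blast
  next
    case (insert i J)
    show ?case
    proof (intro allI impI)
      fix u v :: "'a \<Rightarrow> complex ^ 'b"
      assume uv: "\<forall>j. j \<notin> insert i J \<longrightarrow> u j = v j"
      interpret sesquilinear_form "\<lambda>x y. op_form a (tensor_vec (u(i := x))) (tensor_vec (v(i := y)))"
        by (rule sesquilinear_form_partial)
      \<comment> \<open>With the common vector \<open>z\<close> in factor \<open>i\<close> the two
        families differ only inside \<open>J\<close>.\<close>
      have "op_form a (tensor_vec (u(i := z))) (tensor_vec (v(i := z))) = 0" for z
        using insert.IH uv by (auto simp flip: product_form_def)
      then have "op_form a (tensor_vec (u(i := u i))) (tensor_vec (v(i := v i))) = 0"
        by (rule zero_if_diagonal_zero)
      then show "product_form a u v = 0"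
        by (simp add: product_form_def)
    qed
  qed
  from this[of UNIV] have zero: "product_form a u v = 0" for u v
    by simp
  have "a $ r $ c = 0" for r c
    using zero[of "\<lambda>j. axis (r j) 1" "\<lambda>j. axis (c j) 1"]
    by (simp add: product_form_def tensor_vec_axis op_form_axis(2))
  then show ?thesis
    by (simp add: vec_eq_iff)
qed

text \<open>Rescaling the factors by positive reals multiplies the value by a positive square, and a
  zero factor makes the product vector vanish.\<close>

lemma product_form_nonneg_if_unit:
  assumes "\<And>e. (\<And>j. cinner (e j) (e j) = 1) \<Longrightarrow> 0 \<le> Re (product_form a e e)"
  shows "0 \<le> Re (product_form a e e)"
proof (cases "\<exists>j. e j = 0")
  case True
  then have "tensor_vec e = 0"
    using tensor_vec_eq_0 by blast
  then show ?thesis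
    by (simp add: product_form_def op_form_sum)
next
  case False
  then obtain f c where f: "\<And>j. cinner (f j) (f j) = 1" and c: "\<And>j. 0 < c j"
    and e: "e = (\<lambda>j. complex_of_real (c j) *s f j)"
    using normalize_family[of e] by blast
  interpret sesquilinear_form "op_form a"
    by (rule sesquilinear_form_op_form)
  define C where "C = (\<Prod>j\<in>UNIV. c j)"
  have "tensor_vec e = of_real C *s tensor_vec f"
    by (simp add: e C_def tensor_vec_scale_all)
  then have "product_form a e e = of_real C * (of_real C * product_form a f f)"
    by (simp add: product_form_def scale_left scale_right)
  then have "Re (product_form a e e) = C * C * Re (product_form a f f)"
    by simp
  then show ?thesis
    using assms[OF f] by simp
qed

text \<open>Each local state is a sum of rank one operators, so multilinearity reduces the claim to
  product vectors. These need not be normalized, which is why \<open>nonneg\<close> ranges over all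
  families.\<close>

lemma separable_nonneg:
  assumes herm: "a \<in> hermitian_ops"
    and nonneg: "\<And>e. 0 \<le> Re (product_form a e e)"
    and "p \<in> separable_states"
  shows "0 \<le> hs_inner a p"
proof -
  have tensor: "0 \<le> a \<bullet> tensor_op \<sigma>" if \<sigma>: "\<And>j. \<sigma> j \<in> positive_ops" for \<sigma>
  proof -
    \<comment> \<open>Factors in \<open>J\<close> carry general positive operators, the others rank
      one operators. Quantifying over \<open>e\<close> lets the vectors \<open>v l\<close> of the
      decomposition of \<open>\<sigma> i\<close> be placed in factor \<open>i\<close>.\<close>
    have "\<forall>e. 0 \<le> a \<bullet> tensor_op (\<lambda>j. if j \<in> J then \<sigma> j else ketbra (e j))" if "finite J" for J
      using that
    proof induction
      case empty
      show ?case
        using nonneg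
        by (simp add: tensor_op_ketbra hs_inner_ketbra[OF herm] product_form_def
            flip: hs_inner_eq_inner)
    next
      case (insert i J)
      show ?case
      proof
        fix e :: "'a \<Rightarrow> complex ^ 'b"
        obtain m and v :: "nat \<Rightarrow> complex ^ 'b" where v: "\<sigma> i = (\<Sum>l<m. ketbra (v l))"
          using positive_op_sum_ketbra \<sigma> by blast
        let ?A = "\<lambda>j. if j \<in> J then \<sigma> j else ketbra (e j)"
        have "(\<lambda>j. if j \<in> insert i J then \<sigma> j else ketbra (e j)) = ?A(i := \<sigma> i)"
          by auto
        moreover have "0 \<le> a \<bullet> tensor_op (?A(i := ketbra (v l)))" for l
        proof -
          have "?A(i := ketbra (v l)) = (\<lambda>j. if j \<in> J then \<sigma> j else ketbra ((e(i := v l)) j))"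
            using insert.hyps by auto
          then show ?thesis
            using insert.IH by simp
        qed
        ultimately show "0 \<le> a \<bullet> tensor_op (\<lambda>j. if j \<in> insert i J then \<sigma> j else ketbra (e j))"
          by (simp only: v tensor_op_sum finite_lessThan inner_sum_right) (simp add: sum_nonneg)
      qed
    qed
    from this[of UNIV] show ?thesis
      by simp
  qed
  obtain m c and \<sigma> :: "nat \<Rightarrow> 'a \<Rightarrow> 'b cop"
    where c: "\<forall>i<m. 0 \<le> c i" and \<sigma>: "\<forall>i<m. \<forall>j. \<sigma> i j \<in> states"
      and p: "p = (\<Sum>i<m. c i *\<^sub>R tensor_op (\<sigma> i))"
    using assms(3) unfolding separable_states_def by blast
  have "hs_inner a p = (\<Sum>i<m. c i * (a \<bullet> tensor_op (\<sigma> i)))"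
    by (simp add: hs_inner_eq_inner p inner_sum_right)
  also have "\<dots> \<ge> 0"
    using c \<sigma> by (intro sum_nonneg mult_nonneg_nonneg tensor) (auto simp: states_def)
  finally show ?thesis .
qed

section \<open>The commutator condition\<close>

lemma i_commutator_hermitian:
  assumes "p \<in> hermitian_ops" "t \<in> hermitian_ops"
  shows "i_commutator p t \<in> hermitian_ops"
  using assms
  by (simp add: hermitian_ops_entry i_commutator_def matrix_matrix_mult_def mult.commute
      algebra_simps)

text \<open>With \<open>z = op_form a E (t *v E)\<close>, cyclicity of the trace and Hermiticity
  give \<i> times \<open>cnj z - z\<close>. Geometrically this is the derivative of the expectation
  of \<open>a\<close> along the unitary orbit of \<open>E\<close> generated by
  \<open>t\<close>.\<close>

lemma hs_inner_i_commutator: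
  assumes a: "a \<in> hermitian_ops" and t: "t \<in> hermitian_ops"
  shows "hs_inner (i_commutator (ketbra E) t) a = 2 * Im (op_form a E (t *v E))"
proof -
  define z where "z = op_form a E (t *v E)"
  interpret a: hermitian_form "op_form a"
    using a by (rule hermitian_form_op_form)
  interpret t: hermitian_form "op_form t"
    using t by (rule hermitian_form_op_form)
  have "hs_inner (i_commutator (ketbra E) t) a = hs_inner a (i_commutator (ketbra E) t)"
    by (simp add: hs_inner_eq_inner inner_commute)
  also have "\<dots> = Re (\<i> * (trace (a ** (ketbra E ** t)) - trace (a ** (t ** ketbra E))))"
  proof -
    have "trace (a ** i_commutator (ketbra E) t)
        = \<i> * (trace (a ** (ketbra E ** t)) - trace (a ** (t ** ketbra E)))"
      by (simp add: trace_def matrix_matrix_mult_def[of a] i_commutator_def sum_subtractf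
          sum_distrib_left algebra_simps)
    then show ?thesis
      using a by (simp add: hs_inner_def hermitian_ops_def)
  qed
  also have "trace (a ** (t ** ketbra E)) = z"
    by (simp add: matrix_mul_assoc trace_mult_ketbra op_form_def z_def
        flip: matrix_vector_mul_assoc)
  also have "trace (a ** (ketbra E ** t)) = cnj z"
  proof -
    have "trace (a ** (ketbra E ** t)) = trace ((t ** a) ** ketbra E)"
      by (metis matrix_mul_assoc trace_mul_sym)
    also have "\<dots> = op_form t E (a *v E)"
      by (simp add: trace_mult_ketbra op_form_def flip: matrix_vector_mul_assoc)
    also have "\<dots> = cnj (op_form t (a *v E) E)"
      by (simp add: t.cnj_swap)
    also have "op_form t (a *v E) E = cnj (cinner (t *v E) (a *v E))"
      by (simp add: op_form_def cnj_cinner)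
    also have "cinner (t *v E) (a *v E) = cnj z"
      by (simp add: z_def a.cnj_swap) (simp add: op_form_def)
    finally show ?thesis
      by simp
  qed
  finally show ?thesis
    by (simp add: z_def)
qed

text \<open>A local generator replaces a single factor of the product vector, so \<open>null\<close>
  makes its first-order change of the form vanish; real linearity extends this to
  \<open>tau\<close>.\<close>

lemma commutator_space_subset_hyperplane:
  assumes herm: "a \<in> hermitian_ops"
    and null: "\<And>i v. product_form a e (e(i := v)) = 0"
  shows "commutator_space (ketbra (tensor_vec e)) \<subseteq> hyperplane a"
proof -
  let ?E = "tensor_vec e"
  \<comment> \<open>The Hermitian generators with vanishing first-order change. As a real subspace,
    \<open>?S\<close> contains \<open>tau\<close> as soon as it contains the local
    generators.\<close>
  let ?S = "{t \<in> hermitian_ops. Im (op_form a ?E (t *v ?E)) = 0}"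
  interpret sesquilinear_form "op_form a"
    by (rule sesquilinear_form_op_form)
  have scale: "(r *\<^sub>R t) *v E = complex_of_real r *s (t *v E)" for r and t :: "('a \<Rightarrow> 'b) cop" and E
    by (simp add: vec_eq_iff matrix_vector_mult_def sum_distrib_left scaleR_conv_of_real[symmetric])
  have "subspace ?S"
  proof (rule subspaceI)
    show "0 \<in> ?S"
      by (simp add: subspace_0[OF subspace_hermitian_ops] op_form_sum)
    show "s + t \<in> ?S" if "s \<in> ?S" "t \<in> ?S" for s t
      using that by (simp add: subspace_add[OF subspace_hermitian_ops]
          matrix_vector_mult_add_rdistrib add_right)
    show "r *\<^sub>R t \<in> ?S" if "t \<in> ?S" for r t
      using that by (simp add: subspace_scale[OF subspace_hermitian_ops] scale scale_right)
  qed
  moreover have "local_op i h \<in> ?S" if "h \<in> hermitian_ops" for i h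
    using that null by (simp add: local_op_hermitian local_op_mult_tensor_vec product_form_def)
  then have "tau_factor i \<subseteq> ?S" for i
    unfolding tau_factor_def using \<open>subspace ?S\<close> by (intro span_minimal) auto
  ultimately have "tau \<subseteq> ?S"
    unfolding tau_def by (intro span_minimal) auto
  then show ?thesis
    unfolding commutator_space_def hyperplane_def
    using hs_inner_i_commutator[OF herm] i_commutator_hermitian[OF ketbra_hermitian] by fastforce
qed

text \<open>The map \<open>B\<close> is complex linear and kills \<open>e i\<close>, so only the
  component of \<open>v\<close> orthogonal to \<open>e i\<close> matters. A traceless Hermitian
  local operator sends \<open>e i\<close> to that component, so the commutator condition gives
  \<open>Im (B v) = 0\<close> for every \<open>v\<close>.\<close>

lemma annihilates_of_commutator_unit:
  assumes herm: "a \<in> hermitian_ops"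
    and comm: "commutator_space (ketbra (tensor_vec e)) \<subseteq> hyperplane a"
    and unit: "cinner (e i) (e i) = 1"
    and zero: "product_form a e e = 0"
  shows "product_form a e (e(i := v)) = 0"
proof -
  interpret sesquilinear_form "\<lambda>x y. op_form a (tensor_vec (e(i := x))) (tensor_vec (e(i := y)))"
    by (rule sesquilinear_form_partial)
  define B where "B y = product_form a e (e(i := y))" for y
  have B_add: "B (x + y) = B x + B y" and B_scale: "B (c *s x) = c * B x" for x y c
    using add_right[of "e i"] scale_right[of "e i"] by (simp_all add: B_def product_form_def)
  have B_e: "B (e i) = 0"
    using zero by (simp add: B_def)
  have Im0: "Im (B v) = 0" for v
  proof -
    \<comment> \<open>\<open>w\<close> is the component of \<open>v\<close> orthogonal to the unit
      vector \<open>e i\<close>, and \<open>h\<close> is \<open>|w><e i| + |e i><w|\<close>.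
      Orthogonality makes \<open>h\<close> traceless and gives \<open>h *v e i = w\<close>.\<close>
    define w where "w = v + (- cinner (e i) v) *s e i"
    define h where "h = (\<chi> r c. w $ r * cnj (e i $ c) + e i $ r * cnj (w $ c))"
    have ew: "cinner (e i) w = 0"
      using unit by (simp only: w_def cinner_add_right cinner_scale_right) simp
    then have we: "cinner w (e i) = 0"
      by (metis cnj_cinner complex_cnj_zero)
    have h: "h \<in> hermitian_ops"
      by (simp add: hermitian_ops_entry h_def)
    moreover have "trace h = cinner (e i) w + cinner w (e i)"
      by (simp add: h_def trace_def cinner_def sum.distrib mult.commute)
    ultimately have "local_op i h \<in> tau_factor i"
      unfolding tau_factor_def using ew we by (intro span_base) auto
    then have "local_op i h \<in> tau"
      unfolding tau_def by (intro span_base) auto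
    then have "hs_inner (i_commutator (ketbra (tensor_vec e)) (local_op i h)) a = 0"
      using comm by (auto simp: commutator_space_def hyperplane_def)
    moreover have "h *v e i = w"
    proof -
      have "(h *v e i) $ r = w $ r * cinner (e i) (e i) + e i $ r * cinner w (e i)" for r
        by (simp add: h_def matrix_vector_mult_def cinner_def sum_distrib_left sum.distrib
            algebra_simps)
      then show ?thesis
        by (simp add: vec_eq_iff unit we)
    qed
    ultimately have "Im (B w) = 0"
      by (simp add: hs_inner_i_commutator[OF herm local_op_hermitian[OF h]] B_def
          local_op_mult_tensor_vec product_form_def)
    moreover have "B w = B v"
      by (simp only: w_def B_add B_scale B_e) simp
    ultimately show ?thesis
      by simp
  qed
  \<comment> \<open>By complex linearity the real part of \<open>B v\<close> is the imaginary part
    of \<open>B\<close> at \<open>\<i> *s v\<close>.\<close>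
  have "Re (B v) = 0"
    using Im0[of "\<i> *s v"] by (simp add: B_scale)
  with Im0[of v] show ?thesis
    by (simp add: B_def complex_eq_iff)
qed

text \<open>Condition 2 speaks of unit vectors only. Positive rescaling preserves both the null
  condition and the conclusion, and a family with a zero factor gives the zero vector.\<close>

lemma annihilates_of_commutator:
  assumes herm: "a \<in> hermitian_ops"
    and comm: "\<forall>p\<in>pure_product_states \<inter> hyperplane a. commutator_space p \<subseteq> hyperplane a"
    and zero: "product_form a e e = 0"
  shows "product_form a (e(i := v)) e = 0"
proof (cases "\<exists>j. e j = 0")
  case True
  then have "tensor_vec e = 0"
    using tensor_vec_eq_0 by blast
  then show ?thesis
    by (simp add: product_form_def op_form_sum)
next
  case False
  then obtain f c where f: "\<And>j. cinner (f j) (f j) = 1" and c: "\<And>j. 0 < c j"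
    and e: "e = (\<lambda>j. complex_of_real (c j) *s f j)"
    using normalize_family[of e] by blast
  interpret hermitian_form "op_form a"
    using herm by (rule hermitian_form_op_form)
  define C where "C = (\<Prod>j\<in>UNIV. complex_of_real (c j))"
  have e_f: "tensor_vec e = C *s tensor_vec f"
    by (simp add: e C_def tensor_vec_scale_all)
  have "C \<noteq> 0"
    using c by (auto simp: C_def) (metis less_irrefl)
  then have zero_f: "product_form a f f = 0"
    using zero by (simp add: product_form_def e_f scale_left scale_right)
  then have "ketbra (tensor_vec f) \<in> pure_product_states \<inter> hyperplane a"
    using f hs_inner_ketbra[OF herm, of "tensor_vec f"]
    by (auto simp: pure_product_states_iff hyperplane_def ketbra_hermitian product_form_def
        hs_inner_eq_inner inner_commute)
  then have null: "product_form a f (f(i := u)) = 0" for u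
    using annihilates_of_commutator_unit[OF herm _ f zero_f] comm by blast
  \<comment> \<open>Factor \<open>i\<close> gets weight one, because the inserted \<open>v\<close>
    is not rescaled.\<close>
  have "e(i := v) = (\<lambda>j. (if j = i then 1 else complex_of_real (c j)) *s (f(i := v)) j)"
    by (auto simp: e)
  then have "tensor_vec (e(i := v))
      = (\<Prod>j\<in>UNIV. if j = i then 1 else complex_of_real (c j)) *s tensor_vec (f(i := v))"
    by (simp only: tensor_vec_scale_all)
  moreover have "op_form a (tensor_vec (f(i := v))) (tensor_vec f) = 0"
    using null[of v] cnj_swap by (metis complex_cnj_zero product_form_def)
  ultimately show ?thesis
    by (simp add: product_form_def e_f scale_left scale_right)
qed

text \<open>Induction on the set \<open>J\<close> of factors in which a positive family
  \<open>e\<close> and a negative family \<open>g\<close> may differ. Each step puts a common vector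
  into one factor without losing either sign; for empty \<open>J\<close> the families
  coincide.\<close>

lemma product_form_constant_sign:
  assumes herm: "a \<in> hermitian_ops"
    and null: "\<And>e i v. product_form a e e = 0 \<Longrightarrow> product_form a (e(i := v)) e = 0"
    and pos: "0 < Re (product_form a e e)"
  shows "0 \<le> Re (product_form a g g)"
proof -
  have herm_minus: "- a \<in> hermitian_ops"
    using herm by (simp add: hermitian_ops_entry)
  have minus: "product_form (- a) u v = - product_form a u v" for u v
    by (simp add: product_form_def op_form_sum sum_negf)
  \<comment> \<open>Stated for a general operator \<open>b\<close> so that it applies to
    \<open>a\<close> at \<open>e\<close> and to \<open>- a\<close> at \<open>g\<close>.\<close>
  have semidefinite: "0 \<le> Re (product_form b (e(i := z)) (e(i := z)))"
    if "b \<in> hermitian_ops"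
      and "\<And>e i v. product_form b e e = 0 \<Longrightarrow> product_form b (e(i := v)) e = 0"
      and "0 < Re (product_form b e e)" for b e i z
  proof -
    interpret hermitian_form "\<lambda>x y. op_form b (tensor_vec (e(i := x))) (tensor_vec (e(i := y)))"
      using that(1) by (rule hermitian_form_partial)
    show ?thesis
      unfolding product_form_def
    proof (rule nonneg_if_annihilates_null[of "e i"])
      show "op_form b (tensor_vec (e(i := v))) (tensor_vec (e(i := u))) = 0"
        if "op_form b (tensor_vec (e(i := u))) (tensor_vec (e(i := u))) = 0" for u v
        using \<open>\<And>e i v. product_form b e e = 0 \<Longrightarrow> product_form b (e(i := v)) e = 0\<close>[of "e(i := u)" i v]
          that by (simp add: product_form_def)
    qed (use that(3) in \<open>simp add: product_form_def\<close>)
  qed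
  \<comment> \<open>A null vector of the partial form is annihilated by the whole form, so adding it
    to \<open>e i\<close> leaves the value unchanged.\<close>
  have sum_null: "product_form a (e(i := z + e i)) (e(i := z + e i)) = product_form a e e"
    if "product_form a (e(i := z)) (e(i := z)) = 0" for e i z
  proof -
    interpret hermitian_form "\<lambda>x y. op_form a (tensor_vec (e(i := x))) (tensor_vec (e(i := y)))"
      using herm by (rule hermitian_form_partial)
    have 0: "op_form a (tensor_vec (e(i := v))) (tensor_vec (e(i := z))) = 0" for v
      using null[OF that, of i v] by (simp add: product_form_def)
    then have "op_form a (tensor_vec (e(i := z))) (tensor_vec (e(i := v))) = 0" for v
      by (metis cnj_swap complex_cnj_zero)
    with 0 have "op_form a (tensor_vec (e(i := z + e i))) (tensor_vec (e(i := z + e i)))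
        = op_form a (tensor_vec (e(i := e i))) (tensor_vec (e(i := e i)))"
      by (simp only: add_left add_right) simp
    then show ?thesis
      by (simp add: product_form_def)
  qed
  have "\<forall>e g. (\<forall>j. j \<notin> J \<longrightarrow> e j = g j) \<longrightarrow> 0 < Re (product_form a e e) \<longrightarrow>
      Re (product_form a g g) < 0 \<longrightarrow> False" if "finite J" for J
    using that
  proof induction
    case empty
    have "e = g" if "\<forall>j. j \<notin> {} \<longrightarrow> e j = g j" for e g :: "'a \<Rightarrow> complex ^ 'b"
      using that by auto
    then show ?case
      by fastforce
  next
    case (insert i J)
    show ?case
    proof (intro allI impI)
      fix e g :: "'a \<Rightarrow> complex ^ 'b"
      assume eq: "\<forall>j. j \<notin> insert i J \<longrightarrow> e j = g j"
        and e: "0 < Re (product_form a e e)" and g: "Re (product_form a g g) < 0"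
      have e_nonneg: "0 \<le> Re (product_form a (e(i := z)) (e(i := z)))" for z
        using semidefinite[OF herm null e] .
      have g_nonpos: "Re (product_form a (g(i := z)) (g(i := z))) \<le> 0" for z
        using semidefinite[OF herm_minus, of g i z] null g by (simp add: minus)
      have real: "product_form a u u = 0" if "Re (product_form a u u) = 0" for u
        using that hermitian_form.diagonal_real[OF hermitian_form_op_form[OF herm]]
        by (metis of_real_0 product_form_def)
      have IH: False if "0 < Re (product_form a (e(i := z)) (e(i := z)))"
        "Re (product_form a (g(i := z)) (g(i := z))) < 0" for z
        using insert.IH that eq by (smt (verit) fun_upd_apply insert_iff)
      show False
      \<comment> \<open>If inserting \<open>g i\<close> into \<open>e\<close> gives a nonzero value,
        it is positive and \<open>g i\<close> serves both families. Otherwise, if inserting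
        \<open>e i\<close> into \<open>g\<close> gives a nonzero value, it is negative and
        \<open>e i\<close> serves both. If both values vanish, \<open>g i + e i\<close> keeps the
        two original values.\<close>
      proof (cases "product_form a (e(i := g i)) (e(i := g i)) = 0")
        case False
        then show False
          using IH[of "g i"] e_nonneg[of "g i"] real[of "e(i := g i)"] g by fastforce
      next
        case e0: True
        show False
        proof (cases "product_form a (g(i := e i)) (g(i := e i)) = 0")
          case False
          then show False
            using IH[of "e i"] g_nonpos[of "e i"] real[of "g(i := e i)"] e by fastforce
        next
          case True
          then show False
            using IH[of "g i + e i"] e g sum_null[OF e0] sum_null[OF True] by (simp add: add.commute)
        qed
      qed
    qed
  qed
  from this[of UNIV] pos show ?thesis
    by (meson UNIV_I finite linorder_not_le)
qed

theorem theoremV1: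
  fixes a :: "complex ^ ('k::finite \<Rightarrow> 'n::finite) ^ ('k \<Rightarrow> 'n)"
  assumes "a \<in> hermitian_ops"
  shows "entanglement_witness a \<longleftrightarrow>
    (\<exists>p\<in>pure_product_states. hs_inner p a > 0) \<and>
    (\<forall>p\<in>pure_product_states \<inter> hyperplane a. commutator_space p \<subseteq> hyperplane a) \<and>
    a \<notin> positive_ops"
proof -
  have pure: "hs_inner a (ketbra (tensor_vec e)) = Re (product_form a e e)" for e
    by (simp add: hs_inner_ketbra[OF assms] product_form_def)
  have commute: "hs_inner p a = hs_inner a p" for p
    by (simp add: hs_inner_eq_inner inner_commute)
  have real: "product_form a u u = 0" if "Re (product_form a u u) = 0" for u
    using that hermitian_form.diagonal_real[OF hermitian_form_op_form[OF assms]]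
    by (metis of_real_0 product_form_def)
  show ?thesis
  proof (intro iffI conjI)
    assume wit: "entanglement_witness a"
    then have sep: "\<And>p. p \<in> separable_states \<Longrightarrow> 0 \<le> hs_inner a p"
      by (auto simp: entanglement_witness_def)
    obtain q where q: "q \<in> states" "hs_inner a q < 0"
      using wit by (auto simp: entanglement_witness_def entangled_states_def)
    have nonneg_unit: "0 \<le> Re (product_form a e e)" if "\<And>j. cinner (e j) (e j) = 1" for e
      using sep pure_product_states_separable that
      by (metis (no_types, lifting) pure pure_product_states_iff subsetD)
    then have nonneg: "0 \<le> Re (product_form a e e)" for e
      by (rule product_form_nonneg_if_unit)
    show "\<exists>p\<in>pure_product_states. hs_inner p a > 0"
    proof (rule ccontr)
      assume no: "\<not> ?thesis"
      \<comment> \<open>Without a positive value on pure product states, both \<open>a\<close> and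
        \<open>- a\<close> have nonnegative product forms. The form then vanishes on the diagonal
        and \<open>a = 0\<close>, contradicting the negative value at \<open>q\<close>.\<close>
      have "0 \<le> Re (product_form (- a) e e)" for e
      proof (rule product_form_nonneg_if_unit)
        fix e :: "'k \<Rightarrow> complex ^ 'n"
        assume "\<And>j. cinner (e j) (e j) = 1"
        then have "\<not> 0 < Re (product_form a e e)"
          using no commute pure by (metis pure_product_states_iff)
        then show "0 \<le> Re (product_form (- a) e e)"
          by (simp add: product_form_def op_form_sum sum_negf)
      qed
      then have "Re (product_form a e e) \<le> 0" for e
        by (simp add: product_form_def op_form_sum sum_negf)
      then have "product_form a e e = 0" for e
        using nonneg real by (meson order_antisym)
      then have "a = 0"
        by (rule product_form_zero)
      with q show False
        by (simp add: hs_inner_eq_inner)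
    qed
    show "\<forall>p\<in>pure_product_states \<inter> hyperplane a. commutator_space p \<subseteq> hyperplane a"
    proof
      fix p :: "('k \<Rightarrow> 'n) cop"
      assume p: "p \<in> pure_product_states \<inter> hyperplane a"
      then obtain e where e: "p = ketbra (tensor_vec e)"
        by (auto simp: pure_product_states_iff)
      have zero: "product_form a e e = 0"
        using p by (intro real) (simp add: hyperplane_def e commute pure)
      have "product_form a e (e(i := v)) = 0" for i v
      proof -
        interpret hermitian_form "\<lambda>x y. op_form a (tensor_vec (e(i := x))) (tensor_vec (e(i := y)))"
          using assms by (rule hermitian_form_partial)
        \<comment> \<open>The partial form in factor \<open>i\<close> is positive semidefinite and
          \<open>e i\<close> is a null vector of it.\<close>
        have "op_form a (tensor_vec (e(i := v))) (tensor_vec (e(i := e i))) = 0"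
          by (rule annihilates_null_if_nonneg) (use nonneg zero in \<open>auto simp: product_form_def\<close>)
        then show ?thesis
          using cnj_swap[of v "e i"] by (simp add: product_form_def)
      qed
      then show "commutator_space p \<subseteq> hyperplane a"
        unfolding e by (rule commutator_space_subset_hyperplane[OF assms])
    qed
    show "a \<notin> positive_ops"
    proof
      assume a_pos: "a \<in> positive_ops"
      \<comment> \<open>Writing \<open>q\<close> as a sum of rank one operators turns
        \<open>hs_inner a q\<close> into a sum of values of the quadratic form of
        \<open>a\<close>.\<close>
      obtain m v where "q = (\<Sum>l<(m::nat). ketbra (v l))"
        using q positive_op_sum_ketbra[of q] unfolding states_def by blast
      then have "hs_inner a q = (\<Sum>l<m. hs_inner a (ketbra (v l)))"
        by (simp add: hs_inner_eq_inner inner_sum_right)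
      also have "\<dots> = (\<Sum>l<m. Re (op_form a (v l) (v l)))"
        by (simp add: hs_inner_ketbra[OF assms])
      also have "\<dots> \<ge> 0"
        using a_pos by (auto simp: positive_ops_iff intro: sum_nonneg)
      finally show False
        using q by simp
    qed
  next
    assume conds: "(\<exists>p\<in>pure_product_states. hs_inner p a > 0) \<and>
      (\<forall>p\<in>pure_product_states \<inter> hyperplane a. commutator_space p \<subseteq> hyperplane a) \<and>
      a \<notin> positive_ops"
    then obtain e where "0 < Re (product_form a e e)"
      using commute pure by (metis pure_product_states_iff)
    then have "0 \<le> Re (product_form a g g)" for g
      using product_form_constant_sign[OF assms] annihilates_of_commutator[OF assms] conds by blast
    then have sep: "0 \<le> hs_inner a p" if "p \<in> separable_states" for p
      using separable_nonneg[OF assms] that by blast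
    \<comment> \<open>The normalized negative direction gives a pure state with negative
      expectation; it is entangled because every separable state has a nonnegative one.\<close>
    obtain u where u: "Re (op_form a u u) < 0"
      using conds assms by (auto simp: positive_ops_iff not_le)
    then have "u \<noteq> 0"
      by (auto simp: op_form_sum)
    then obtain f where f: "cinner f f = 1" and u_f: "u = of_real (norm u) *s f"
      using normalize_vector by blast
    interpret sesquilinear_form "op_form a"
      by (rule sesquilinear_form_op_form)
    have "op_form a u u = of_real (norm u) * (of_real (norm u) * op_form a f f)"
      by (metis complex_cnj_complex_of_real scale_left scale_right u_f)
    then have "Re (op_form a f f) < 0"
      using u by (simp add: mult_less_0_iff)
    then have "hs_inner a (ketbra f) < 0"
      by (simp add: hs_inner_ketbra[OF assms])
    moreover from this have "ketbra f \<in> entangled_states"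
      using ketbra_in_states[OF f] sep by (fastforce simp: entangled_states_def)
    ultimately show "entanglement_witness a"
      using assms sep by (auto simp: entanglement_witness_def)
  qed
qed

end
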